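(* Let $X$ be a completely regular space and let $H$ be a Banach subalgebra of $C_b(X)$ such that (1) for any $x\in X$ there is some $h\in H$ with $h(x)\neq 0$; (2) for any $f\in C_b(X)$, if $\mathrm{supp}(f)\subseteq\mathrm{supp}(h)$ for some $h\in H$, then $f\in H$. Then $H$ is isometrically isomorphic to $C_0(Y)$ for some locally compact Hausdorff space $Y$ which is unique up to homeomorphism, namely $Y=\lambda_H X$, where \[\lambda_H X=\bigcup\big\{\mathrm{int}_{\beta X}\mathrm{cl}_{\beta X}\mathrm{Coz}(h):h\in H\big\}\subseteq\beta X.\] Furthermore, with $Y=\lambda_H X$, the following are equivalent: (a) $H$ is unital (that is, the algebra $H$ has a unit element); (b) $H$ contains the constant function $\mathbf{1}$; (c) $Y$ is compact; (d) $Y=\beta X$.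
   Context: Completely regular spaces are assumed to be Hausdorff. The scalar field is either $\mathbb{R}$ or $\mathbb{C}$, fixed throughout. $C_b(X)$ is the Banach algebra of all continuous bounded scalar-valued functions on $X$ with pointwise operations and the supremum norm; a Banach subalgebra of $C_b(X)$ is a subalgebra closed in this norm (not required to contain $\mathbf{1}$). For $f\in C_b(X)$, $\mathrm{Coz}(f)=\{x\in X: f(x)\neq 0\}$ and $\mathrm{supp}(f)=\mathrm{cl}_X\mathrm{Coz}(f)$. $C_0(Y)$ is the set of all $f\in C_b(Y)$ vanishing at infinity, i.e. such that $|f|^{-1}([\epsilon,\infty))$ is compact for each $\epsilon>0$. $\beta X$ is the Stone–Čech compactification of $X$, with $X$ regarded as a dense subspace of $\beta X$. An isometric isomorphism is a norm-preserving algebra isomorphism. *)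

theory Defs
  imports "HOL-Analysis.Analysis"
begin

section \<open>The scalar field\<close>

text \<open>
  The members of this class are the real and the complex numbers, up to an isometric isomorphism of
  real algebras. A theorem about a scalar type of this class is thus a theorem about the reals and
  about the complex numbers.
\<close>

class real_or_complex = real_normed_field +
  assumes real_or_complex:
    "(\<exists>\<phi> :: 'a \<Rightarrow> real. surj \<phi> \<and> (\<forall>a b. \<phi> (a + b) = \<phi> a + \<phi> b) \<and> (\<forall>r a. \<phi> (r *\<^sub>R a) = r *\<^sub>R \<phi> a) \<and>
        (\<forall>a b. \<phi> (a * b) = \<phi> a * \<phi> b) \<and> (\<forall>a. norm (\<phi> a) = norm a)) \<or>
     (\<exists>\<phi> :: 'a \<Rightarrow> complex. surj \<phi> \<and> (\<forall>a b. \<phi> (a + b) = \<phi> a + \<phi> b) \<and> (\<forall>r a. \<phi> (r *\<^sub>R a) = r *\<^sub>R \<phi> a) \<and>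
        (\<forall>a b. \<phi> (a * b) = \<phi> a * \<phi> b) \<and> (\<forall>a. norm (\<phi> a) = norm a))"

instance real :: real_or_complex
  by standard (rule disjI1, rule exI[of _ "\<lambda>a. a"], auto)

instance complex :: real_or_complex
  by standard (rule disjI2, rule exI[of _ "\<lambda>a. a"], auto)

lemma heine_borel_transfer:
  fixes \<phi> :: "'a::real_normed_vector \<Rightarrow> 'b::{real_normed_vector,heine_borel}" and f :: "nat \<Rightarrow> 'a"
  assumes lin: "linear \<phi>" and sur: "surj \<phi>" and iso: "\<And>a. norm (\<phi> a) = norm a"
    and bdd: "bounded (range f)"
  shows "\<exists>l r. strict_mono (r::nat\<Rightarrow>nat) \<and> (f \<circ> r) \<longlonglongrightarrow> l"
proof -
  have "bounded (range (\<phi> \<circ> f))"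
    using bdd iso by (auto simp: bounded_iff)
  then obtain m r where r: "strict_mono (r::nat\<Rightarrow>nat)" and lim: "((\<phi> \<circ> f) \<circ> r) \<longlonglongrightarrow> m"
    using bounded_imp_convergent_subsequence by blast
  obtain l where l: "m = \<phi> l"
    using sur by (metis surjD)
  have "dist ((f \<circ> r) n) l = dist (((\<phi> \<circ> f) \<circ> r) n) m" for n
    by (simp add: dist_norm l iso flip: linear_diff[OF lin])
  then have "(f \<circ> r) \<longlonglongrightarrow> l"
    using lim by (simp add: tendsto_dist_iff[of "f \<circ> r"] tendsto_dist_iff[of "(\<phi> \<circ> f) \<circ> r"])
  with r show ?thesis by blast
qed

instance real_or_complex \<subseteq> heine_borel
proof
  fix f :: "nat \<Rightarrow> 'a"
  assume f: "bounded (range f)"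
  from real_or_complex[where 'a='a]
  show "\<exists>l r. strict_mono (r::nat\<Rightarrow>nat) \<and> (f \<circ> r) \<longlonglongrightarrow> l"
  proof (elim disjE exE conjE)
    fix \<phi> :: "'a \<Rightarrow> real"
    assume "surj \<phi>" "\<forall>a b. \<phi> (a + b) = \<phi> a + \<phi> b" "\<forall>r a. \<phi> (r *\<^sub>R a) = r *\<^sub>R \<phi> a"
      "\<forall>a. norm (\<phi> a) = norm a"
    then show ?thesis
      by (intro heine_borel_transfer[OF _ _ _ f, of \<phi>] linearI) simp_all
  next
    fix \<phi> :: "'a \<Rightarrow> complex"
    assume "surj \<phi>" "\<forall>a b. \<phi> (a + b) = \<phi> a + \<phi> b" "\<forall>r a. \<phi> (r *\<^sub>R a) = r *\<^sub>R \<phi> a"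
      "\<forall>a. norm (\<phi> a) = norm a"
    then show ?thesis
      by (intro heine_borel_transfer[OF _ _ _ f, of \<phi>] linearI) simp_all
  qed
qed


section \<open>Function algebras\<close>

text \<open>
  A function on the space \<open>X\<close> is represented by its extension by zero to the whole type, so that
  equality of functions on \<open>X\<close> is equality, the algebra operations are pointwise operations on the
  type, and the supremum may be taken over the whole type (it is \<open>0\<close> if \<open>X\<close> is empty).
\<close>

definition Cb :: "'a topology \<Rightarrow> ('a \<Rightarrow> 'k::real_normed_field) set" where
  "Cb X = {f. continuous_map X euclidean f \<and> bounded (f ` topspace X) \<and> (\<forall>x. x \<notin> topspace X \<longrightarrow> f x = 0)}"

definition sup_norm :: "('a \<Rightarrow> 'k::real_normed_field) \<Rightarrow> real" where
  "sup_norm f = (SUP x. norm (f x))"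

definition one_on :: "'a topology \<Rightarrow> 'a \<Rightarrow> 'k::real_normed_field" where
  "one_on X = (\<lambda>x. if x \<in> topspace X then 1 else 0)"

definition banach_subalgebra :: "'a topology \<Rightarrow> ('a \<Rightarrow> 'k::real_normed_field) set \<Rightarrow> bool" where
  "banach_subalgebra X H \<longleftrightarrow>
     H \<subseteq> Cb X \<and>
     (\<lambda>x. 0) \<in> H \<and>
     (\<forall>f\<in>H. \<forall>g\<in>H. (\<lambda>x. f x + g x) \<in> H) \<and>
     (\<forall>c. \<forall>f\<in>H. (\<lambda>x. c * f x) \<in> H) \<and>
     (\<forall>f\<in>H. \<forall>g\<in>H. (\<lambda>x. f x * g x) \<in> H) \<and>
     (\<forall>f\<in>Cb X. (\<forall>e>0. \<exists>h\<in>H. sup_norm (\<lambda>x. f x - h x) < e) \<longrightarrow> f \<in> H)"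

definition unital :: "('a \<Rightarrow> 'k::real_normed_field) set \<Rightarrow> bool" where
  "unital H \<longleftrightarrow> (\<exists>u\<in>H. \<forall>h\<in>H. (\<lambda>x. u x * h x) = h \<and> (\<lambda>x. h x * u x) = h)"

definition Coz :: "'a topology \<Rightarrow> ('a \<Rightarrow> 'k::real_normed_field) \<Rightarrow> 'a set" where
  "Coz X f = {x \<in> topspace X. f x \<noteq> 0}"

definition supp :: "'a topology \<Rightarrow> ('a \<Rightarrow> 'k::real_normed_field) \<Rightarrow> 'a set" where
  "supp X f = X closure_of (Coz X f)"

definition C0 :: "'a topology \<Rightarrow> ('a \<Rightarrow> 'k::real_normed_field) set" where
  "C0 Y = {f \<in> Cb Y. \<forall>e>0. compactin Y {y \<in> topspace Y. norm (f y) \<ge> e}}"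

definition isometrically_isomorphic ::
    "('a \<Rightarrow> 'k::real_normed_field) set \<Rightarrow> ('b \<Rightarrow> 'k) set \<Rightarrow> bool" where
  "isometrically_isomorphic A B \<longleftrightarrow>
     (\<exists>T. bij_betw T A B \<and>
          (\<forall>f\<in>A. \<forall>g\<in>A. T (\<lambda>x. f x + g x) = (\<lambda>y. T f y + T g y)) \<and>
          (\<forall>c. \<forall>f\<in>A. T (\<lambda>x. c * f x) = (\<lambda>y. c * T f y)) \<and>
          (\<forall>f\<in>A. \<forall>g\<in>A. T (\<lambda>x. f x * g x) = (\<lambda>y. T f y * T g y)) \<and>
          (\<forall>f\<in>A. sup_norm (T f) = sup_norm f))"


section \<open>The Stone-Cech compactification\<close>

text \<open>
  \<open>beta X\<close> is the closure of the image of \<open>X\<close> under the evaluation map into the cube indexed by the continuous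
  functions from \<open>X\<close> to the unit interval. It comes with the evaluation map
  \<open>beta_embed X\<close> as embedding of \<open>X\<close>;
  the lemmas below confirm the characteristic properties.
\<close>

definition unit_functions :: "'a topology \<Rightarrow> ('a \<Rightarrow> real) set" where
  "unit_functions X = {f \<in> extensional (topspace X). continuous_map X (top_of_set {0..1}) f}"

definition unit_cube :: "'a topology \<Rightarrow> (('a \<Rightarrow> real) \<Rightarrow> real) topology" where
  "unit_cube X = product_topology (\<lambda>f. top_of_set {0..1}) (unit_functions X)"

definition beta_embed :: "'a topology \<Rightarrow> 'a \<Rightarrow> (('a \<Rightarrow> real) \<Rightarrow> real)" where
  "beta_embed X x = (\<lambda>f\<in>unit_functions X. f x)"

definition beta :: "'a topology \<Rightarrow> (('a \<Rightarrow> real) \<Rightarrow> real) topology" where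
  "beta X = subtopology (unit_cube X) (unit_cube X closure_of (beta_embed X ` topspace X))"

definition lambda_set :: "'a topology \<Rightarrow> ('a \<Rightarrow> 'k::real_normed_field) set \<Rightarrow> (('a \<Rightarrow> real) \<Rightarrow> real) set" where
  "lambda_set X H = (\<Union>h\<in>H. beta X interior_of (beta X closure_of (beta_embed X ` Coz X h)))"

definition lambda_space :: "'a topology \<Rightarrow> ('a \<Rightarrow> 'k::real_normed_field) set \<Rightarrow> (('a \<Rightarrow> real) \<Rightarrow> real) topology" where
  "lambda_space X H = subtopology (beta X) (lambda_set X H)"

lemma unit_functions_eq:
  "unit_functions X = mspace (submetric (cfunspace X euclidean_metric) {f. f \<in> topspace X \<rightarrow> {0..1}})"
proof -
  have "bounded (f ` topspace X)" if "f \<in> topspace X \<rightarrow> {0..1::real}" for f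
    using that by (metis bounded_closed_interval bounded_subset image_subset_iff_funcset)
  then show ?thesis
    by (auto simp: unit_functions_def continuous_map_in_subtopology)
qed

lemma compact_space_unit_cube: "compact_space (unit_cube X)"
  by (simp add: unit_cube_def compact_space_product_topology compact_space_subtopology)

lemma Hausdorff_space_unit_cube: "Hausdorff_space (unit_cube X)"
  by (simp add: unit_cube_def Hausdorff_space_product_topology Hausdorff_space_subtopology)

lemma compact_space_beta: "compact_space (beta X)"
  by (simp add: beta_def compact_space_unit_cube closedin_compact_space compact_space_subtopology)

lemma Hausdorff_space_beta: "Hausdorff_space (beta X)"
  by (simp add: beta_def Hausdorff_space_unit_cube Hausdorff_space_subtopology)

lemma embedding_map_beta_embed_cube:
  assumes "completely_regular_space X" "Hausdorff_space X"
  shows "embedding_map X (unit_cube X) (beta_embed X)"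
  using completely_regular_space_cube_embedding_explicit[OF assms]
  by (simp add: unit_cube_def beta_embed_def[abs_def] unit_functions_eq)

lemma continuous_map_beta_embed_cube: "continuous_map X (unit_cube X) (beta_embed X)"
  by (auto simp: unit_cube_def beta_embed_def continuous_map_componentwise unit_functions_def)

lemma beta_embed_subset: "beta_embed X ` topspace X \<subseteq> unit_cube X closure_of (beta_embed X ` topspace X)"
  using continuous_map_image_subset_topspace[OF continuous_map_beta_embed_cube]
  by (rule closure_of_subset)

lemma embedding_map_beta_embed:
  assumes "completely_regular_space X" "Hausdorff_space X"
  shows "embedding_map X (beta X) (beta_embed X)"
  using embedding_map_beta_embed_cube[OF assms] beta_embed_subset[of X]
  by (simp add: beta_def embedding_map_in_subtopology)

lemma dense_beta_embed: "beta X closure_of (beta_embed X ` topspace X) = topspace (beta X)"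
  using beta_embed_subset[of X]
  by (simp add: beta_def closure_of_subtopology Int_absorb1 closure_of_subset_topspace)

lemma beta_extension:
  assumes Z: "compact_space Z" "Hausdorff_space Z" and f: "continuous_map X Z f"
  shows "\<exists>F. continuous_map (beta X) Z F \<and> (\<forall>x\<in>topspace X. F (beta_embed X x) = f x)"
proof -
  have "normal_space Z"
    using Z by (simp add: compact_Hausdorff_or_regular_imp_normal_space)
  then have "completely_regular_space Z"
    using Z by (simp add: normal_imp_completely_regular_space)
  then have emb: "embedding_map Z (unit_cube Z) (beta_embed Z)"
    using Z by (simp add: embedding_map_beta_embed_cube)
  define e where "e = beta_embed Z ` topspace Z"
  obtain k where k: "homeomorphic_maps Z (subtopology (unit_cube Z) e) (beta_embed Z) k"
    using emb unfolding embedding_map_def homeomorphic_map_maps e_def by blast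
  have "compactin (unit_cube Z) e"
    using Z(1) unfolding e_def compact_space_def
    by (rule image_compactin[OF _ continuous_map_beta_embed_cube])
  then have clo: "closedin (unit_cube Z) e"
    by (rule compactin_imp_closedin[OF Hausdorff_space_unit_cube])
  define G where "G = (\<lambda>p. \<lambda>g\<in>unit_functions Z. p (restrict (g \<circ> f) (topspace X)) :: real)"
  have fT: "f \<in> topspace X \<rightarrow> topspace Z"
    using f by (simp add: continuous_map_def)
  have comp: "restrict (g \<circ> f) (topspace X) \<in> unit_functions X" if "g \<in> unit_functions Z" for g
  proof -
    have "continuous_map X (top_of_set {0..1}) (g \<circ> f)"
      using that f continuous_map_compose unfolding unit_functions_def by blast
    then show ?thesis
      unfolding unit_functions_def
      by (auto intro: continuous_map_eq[where f = "g \<circ> f"])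
  qed
  have contG: "continuous_map (unit_cube X) (unit_cube Z) G"
    unfolding unit_cube_def[of Z]
  proof (subst continuous_map_componentwise, intro conjI ballI)
    show "G ` topspace (unit_cube X) \<subseteq> extensional (unit_functions Z)"
      by (auto simp: G_def)
    fix g assume g: "g \<in> unit_functions Z"
    have "continuous_map (unit_cube X) (top_of_set {0..1}) (\<lambda>p. p (restrict (g \<circ> f) (topspace X)))"
      unfolding unit_cube_def using continuous_map_product_projection[OF comp[OF g]] by blast
    then show "continuous_map (unit_cube X) (top_of_set {0..1}) (\<lambda>p. G p g)"
      using g by (simp add: G_def)
  qed
  have Ge: "G (beta_embed X x) = beta_embed Z (f x)" if "x \<in> topspace X" for x
    using that comp by (auto simp: G_def beta_embed_def)
  have "G ` (unit_cube X closure_of (beta_embed X ` topspace X))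
        \<subseteq> unit_cube Z closure_of (G ` (beta_embed X ` topspace X))"
    using contG continuous_map_image_closure_subset by blast
  also have "\<dots> \<subseteq> e"
    using clo Ge fT by (intro closure_of_minimal) (auto simp: e_def)
  finally have "continuous_map (beta X) (subtopology (unit_cube Z) e) G"
    unfolding beta_def continuous_map_in_subtopology
    using contG continuous_map_from_subtopology by fastforce
  then have "continuous_map (beta X) Z (k \<circ> G)"
    using k continuous_map_compose unfolding homeomorphic_maps_def by blast
  moreover have "(k \<circ> G) (beta_embed X x) = f x" if "x \<in> topspace X" for x
    using that Ge fT k unfolding homeomorphic_maps_def by auto
  ultimately show ?thesis by blast
qed

end

theory Submission
  imports Defs
begin

text \<open>
  The isomorphism from \<open>C0 (lambda_space X H)\<close> to \<open>H\<close> is restriction along the embedding of \<open>X\<close> into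
  \<open>beta X\<close>. The functions whose restriction lies in \<open>H\<close> form an ideal, because products have smaller
  supports, and this ideal vanishes at no point, because \<open>H\<close> contains every restriction of a function
  supported in the interior of the closure of \<open>Coz X h\<close>. Such an ideal is dense, so all restrictions lie
  in the closed algebra \<open>H\<close>. Conversely the extension of \<open>f \<in> H\<close> to \<open>beta X\<close> vanishes off the lambda
  set. Uniqueness is the Banach-Stone theorem: the kernel of a contractive character of \<open>C0 Y\<close> is a
  proper closed ideal, hence has a common zero by the same density, at which the character evaluates.
\<close>


section \<open>Bounded functions and functions vanishing at infinity\<close>

lemma continuous_map_tendsto:
  "continuous_map X euclidean f \<longleftrightarrow> (\<forall>x\<in>topspace X. (f \<longlongrightarrow> f x) (atin X x))"
  by (simp add: continuous_map_atin)

lemma Cb_continuous: "f \<in> Cb X \<Longrightarrow> continuous_map X euclidean f"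
  by (simp add: Cb_def)

lemma Cb_outside: "f \<in> Cb X \<Longrightarrow> x \<notin> topspace X \<Longrightarrow> f x = 0"
  by (simp add: Cb_def)

lemma CbI:
  assumes "continuous_map X euclidean f" "\<And>x. x \<in> topspace X \<Longrightarrow> norm (f x) \<le> B"
    "\<And>x. x \<notin> topspace X \<Longrightarrow> f x = 0"
  shows "f \<in> Cb X"
  using assms unfolding Cb_def bounded_iff by blast

lemma Cb_bounded_range:
  assumes "f \<in> Cb X"
  shows "bounded (range f)"
proof -
  have "range f \<subseteq> insert 0 (f ` topspace X)"
    using Cb_outside[OF assms] by blast
  moreover have "bounded (insert 0 (f ` topspace X))"
    using assms by (simp add: Cb_def)
  ultimately show ?thesis
    using bounded_subset by blast
qed

lemma norm_le_sup_norm: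
  assumes "bounded (range f)"
  shows "norm (f x) \<le> sup_norm f"
  unfolding sup_norm_def
proof (rule cSUP_upper)
  show "bdd_above (range (\<lambda>x. norm (f x)))"
    using assms by (auto simp: bounded_iff bdd_above_def)
qed simp

lemma sup_norm_le: "(\<And>x. norm (f x) \<le> B) \<Longrightarrow> sup_norm f \<le> B"
  unfolding sup_norm_def by (rule cSUP_least) auto

lemma Cb_norm_le: "f \<in> Cb X \<Longrightarrow> norm (f x) \<le> sup_norm f"
  by (simp add: Cb_bounded_range norm_le_sup_norm)

lemma Cb_add: "f \<in> Cb X \<Longrightarrow> g \<in> Cb X \<Longrightarrow> (\<lambda>x. f x + g x) \<in> Cb X"
  by (rule CbI[where B = "sup_norm f + sup_norm g"])
    (auto simp: continuous_map_tendsto Cb_outside dest: Cb_continuous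
      intro!: tendsto_add norm_triangle_mono Cb_norm_le)

lemma Cb_mult: "f \<in> Cb X \<Longrightarrow> g \<in> Cb X \<Longrightarrow> (\<lambda>x. f x * g x) \<in> Cb X"
  by (rule CbI[where B = "sup_norm f * sup_norm g"])
    (auto simp: continuous_map_tendsto Cb_outside norm_mult dest: Cb_continuous
      intro!: tendsto_mult mult_mono' Cb_norm_le)

lemma Cb_scale: "f \<in> Cb X \<Longrightarrow> (\<lambda>x. c * f x) \<in> Cb X"
  by (rule CbI[where B = "norm c * sup_norm f"])
    (auto simp: continuous_map_tendsto Cb_outside norm_mult dest: Cb_continuous
      intro!: tendsto_mult mult_left_mono Cb_norm_le)

section \<open>Functions vanishing at infinity\<close>

lemma C0_Cb: "f \<in> C0 X \<Longrightarrow> f \<in> Cb X"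
  by (simp add: C0_def)

lemma C0_compactin: "f \<in> C0 Y \<Longrightarrow> e > 0 \<Longrightarrow> compactin Y {y \<in> topspace Y. norm (f y) \<ge> e}"
  by (simp add: C0_def)

text \<open>The superlevel set of \<open>norm (f y)\<close> is closed by continuity and lies in
  \<open>K\<close>, hence is compact. It is therefore enough to produce any compact set off which
  \<open>f\<close> is small.\<close>

lemma C0I:
  assumes f: "f \<in> Cb Y"
    and K: "\<And>e. e > 0 \<Longrightarrow> \<exists>K. compactin Y K \<and> (\<forall>y\<in>topspace Y - K. norm (f y) < e)"
  shows "f \<in> C0 Y"
proof -
  have "compactin Y {y \<in> topspace Y. norm (f y) \<ge> e}" if e: "e > 0" for e
  proof -
    obtain K where K: "compactin Y K" "\<forall>y\<in>topspace Y - K. norm (f y) < e"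
      using K[OF e] by blast
    have "continuous_map Y euclideanreal (\<lambda>y. norm (f y))"
      using Cb_continuous[OF f] by (simp add: continuous_map_tendsto tendsto_norm)
    from closedin_continuous_map_preimage[OF this, of "{e..}"]
    have "closedin Y {y \<in> topspace Y. norm (f y) \<ge> e}"
      by simp
    then show ?thesis
      using K by (intro closed_compactin[OF K(1)]) force+
  qed
  with f show ?thesis by (simp add: C0_def)
qed

lemma C0_zero: "(\<lambda>x. 0) \<in> C0 Y"
  by (rule C0I) (auto intro!: CbI[where B = 0] exI[of _ "{}"])

lemma C0_add:
  assumes f: "f \<in> C0 Y" and g: "g \<in> C0 Y"
  shows "(\<lambda>x. f x + g x) \<in> C0 Y"
proof (rule C0I)
  fix e :: real assume "e > 0"
  let ?K = "{y \<in> topspace Y. norm (f y) \<ge> e/2} \<union> {y \<in> topspace Y. norm (g y) \<ge> e/2}"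
  have "compactin Y ?K"
    using \<open>e > 0\<close> by (intro compactin_Un C0_compactin f g) auto
  moreover have "norm (f y + g y) < e" if "y \<in> topspace Y - ?K" for y
    using that norm_triangle_ineq[of "f y" "g y"] by auto
  ultimately show "\<exists>K. compactin Y K \<and> (\<forall>y\<in>topspace Y - K. norm (f y + g y) < e)"
    by blast
qed (use f g in \<open>simp add: C0_Cb Cb_add\<close>)

text \<open>Superlevel sets of \<open>g\<close> lie in superlevel sets of \<open>f\<close>.
  Products, scalar multiples and the conjugate below are all obtained from this domination.\<close>

lemma C0_dominated:
  assumes f: "f \<in> C0 Y" and g: "continuous_map Y euclidean g"
    and le: "\<And>y. norm (g y) \<le> B * norm (f y)"
  shows "g \<in> C0 Y"
proof (rule C0I)
  \<comment> \<open>\<open>B\<close> may be zero or negative; \<open>max B 1\<close> is a positive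
    factor that can be divided by.\<close>
  have le': "norm (g y) \<le> max B 1 * norm (f y)" for y
    using le[of y] by (rule order_trans) (simp add: mult_right_mono)
  show "g \<in> Cb Y"
  proof (rule CbI[OF g])
    show "norm (g x) \<le> max B 1 * sup_norm f" for x
      using le'[of x] by (rule order_trans) (intro mult_left_mono Cb_norm_le[OF C0_Cb[OF f]], simp)
    show "g x = 0" if "x \<notin> topspace Y" for x
      using le[of x] Cb_outside[OF C0_Cb[OF f] that] by simp
  qed
  fix e :: real assume "e > 0"
  let ?K = "{y \<in> topspace Y. norm (f y) \<ge> e / max B 1}"
  have "compactin Y ?K"
    using \<open>e > 0\<close> by (intro C0_compactin f) auto
  moreover have "norm (g y) < e" if "y \<in> topspace Y - ?K" for y
  proof -
    have "norm (f y) < e / max B 1"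
      using that by auto
    then have "max B 1 * norm (f y) < e"
      by (simp add: pos_less_divide_eq mult.commute)
    with le'[of y] show ?thesis by linarith
  qed
  ultimately show "\<exists>K. compactin Y K \<and> (\<forall>y\<in>topspace Y - K. norm (g y) < e)"
    by blast
qed

lemma C0_mult:
  assumes f: "f \<in> C0 Y" and g: "g \<in> Cb Y"
  shows "(\<lambda>x. f x * g x) \<in> C0 Y"
proof (rule C0_dominated[OF f, where B = "sup_norm g"])
  show "continuous_map Y euclidean (\<lambda>x. f x * g x)"
    using Cb_mult[OF C0_Cb[OF f] g] by (rule Cb_continuous)
  show "norm (f y * g y) \<le> sup_norm g * norm (f y)" for y
    using Cb_norm_le[OF g, of y] by (simp add: norm_mult mult.commute[of "norm (f y)"] mult_right_mono)
qed

lemma C0_scale: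
  assumes f: "f \<in> C0 Y"
  shows "(\<lambda>x. c * f x) \<in> C0 Y"
  by (rule C0_dominated[OF f, where B = "norm c"])
    (use Cb_continuous[OF Cb_scale[OF C0_Cb[OF f]]] in \<open>auto simp: norm_mult\<close>)

lemma C0_minus:
  assumes "f \<in> C0 Y" "g \<in> C0 Y"
  shows "(\<lambda>x. f x - g x) \<in> C0 Y"
  using C0_add[OF assms(1) C0_scale[OF assms(2), of "-1"]] by simp

text \<open>Local compactness puts a compact neighbourhood \<open>K\<close> of \<open>p\<close>
  inside \<open>U\<close>, and complete regularity gives a function \<open>g\<close> that is 0 at
  \<open>p\<close> and 1 off the open part \<open>V\<close> of \<open>K\<close>. Then
  \<open>1 - g\<close>, cut to the space, vanishes off \<open>K\<close>.\<close>

lemma C0_urysohn: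
  assumes lc: "locally_compact_space Y" and H: "Hausdorff_space Y" and U: "openin Y U" "p \<in> U"
  obtains f :: "'a \<Rightarrow> 'k::real_normed_field"
  where "f \<in> C0 Y" "f p = 1" "\<And>y. y \<notin> U \<Longrightarrow> f y = 0"
proof -
  have reg: "regular_space Y"
    using lc H locally_compact_Hausdorff_imp_regular_space by blast
  then have cr: "completely_regular_space Y"
    using lc locally_compact_regular_imp_completely_regular_space by blast
  obtain V K where V: "openin Y V" "compactin Y K" "p \<in> V" "V \<subseteq> K" "K \<subseteq> U"
    using lc H U unfolding locally_compact_space_neighbourhood_base_closedin[OF disjI1[OF H]]
      neighbourhood_base_of by meson
  have p: "p \<in> topspace Y - (topspace Y - V)"
    using V openin_subset by blast
  obtain g :: "'a \<Rightarrow> real" where g: "continuous_map Y (top_of_set {0..1}) g" "g p = 0"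
    "g ` (topspace Y - V) \<subseteq> {1}"
    using cr V(1) p unfolding completely_regular_space_def by (meson openin_closedin_eq)
  define f :: "'a \<Rightarrow> 'k" where "f = (\<lambda>y. if y \<in> topspace Y then of_real (1 - g y) else 0)"
  have g1: "continuous_map Y euclideanreal g" "g \<in> topspace Y \<rightarrow> {0..1}"
    using g(1) by (auto simp: continuous_map_in_subtopology)
  have "continuous_map Y euclidean (\<lambda>y. of_real (1 - g y) :: 'k)"
    using g1(1) by (auto simp: continuous_map_tendsto intro!: tendsto_intros)
  then have "continuous_map Y euclidean f"
    by (rule continuous_map_eq) (simp add: f_def)
  then have "f \<in> Cb Y"
  proof (rule CbI)
    show "norm (f x) \<le> 1" if "x \<in> topspace Y" for x
      using g1(2) that unfolding f_def by (simp add: Pi_iff del: of_real_diff)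
  qed (simp add: f_def)
  then have "f \<in> C0 Y"
  proof (rule C0I)
    have "f y = 0" if "y \<in> topspace Y - K" for y
      using that V(4) g(3) by (auto simp: f_def)
    then show "\<exists>K. compactin Y K \<and> (\<forall>y\<in>topspace Y - K. norm (f y) < e)" if "e > 0" for e
      using V(2) that by auto
  qed
  moreover have "f p = 1"
    using p g(2) by (simp add: f_def)
  moreover have "f y = 0" if "y \<notin> U" for y
    using that V(4,5) g(3) by (auto simp: f_def)
  ultimately show thesis
    using that by blast
qed

section \<open>Ideals and characters\<close>

lemma C0_ideal_sum:
  assumes "(\<lambda>x. 0) \<in> J" "\<And>f g. f \<in> J \<Longrightarrow> g \<in> J \<Longrightarrow> (\<lambda>x. f x + g x) \<in> J"
    and "finite F" "\<And>i. i \<in> F \<Longrightarrow> h i \<in> J"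
  shows "(\<lambda>x. \<Sum>i\<in>F. h i x) \<in> J"
  using assms(3,4) by (induction F) (simp_all add: assms(1,2))

lemma norm_norm_square_inverse:
  "norm (of_real ((norm a)\<^sup>2) * inverse a) = norm (a :: 'k::real_normed_field)"
  by (cases "a = 0") (simp_all add: norm_mult norm_inverse power2_eq_square)

text \<open>\<open>(norm a)\<^sup>2 / a\<close> plays the role of the complex conjugate of \<open>a\<close>; it is \<open>0\<close> for \<open>a = 0\<close>.\<close>

lemma continuous_norm_square_inverse:
  "((\<lambda>a::'k::real_normed_field. of_real ((norm a)\<^sup>2) * inverse a) \<longlongrightarrow> of_real ((norm b)\<^sup>2) * inverse b) (nhds b)"
proof (cases "b = 0")
  case True
  have "((\<lambda>a::'k. norm a) \<longlongrightarrow> 0) (nhds 0)"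
    using tendsto_norm[OF filterlim_ident, of "0::'k"] by simp
  then have "((\<lambda>a::'k. of_real ((norm a)\<^sup>2) * inverse a) \<longlongrightarrow> 0) (nhds 0)"
    by (rule Lim_null_comparison[rotated])
      (simp add: norm_norm_square_inverse del: of_real_power)
  with True show ?thesis by simp
next
  case False
  then show ?thesis
    by (intro tendsto_intros filterlim_ident)
qed

text \<open>This substitute for the conjugate of \<open>f\<close> has the same modulus as
  \<open>f\<close>, so \<open>f\<close> dominates it with constant 1.\<close>

lemma C0_norm_square_inverse:
  fixes f :: "'a \<Rightarrow> 'k::real_normed_field"
  assumes f: "f \<in> C0 Y"
  shows "(\<lambda>x. of_real ((norm (f x))\<^sup>2) * inverse (f x)) \<in> C0 Y"
proof (rule C0_dominated[OF f, where B = 1])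
  show "continuous_map Y euclidean (\<lambda>x. of_real ((norm (f x))\<^sup>2) * inverse (f x))"
    unfolding continuous_map_tendsto
  proof
    fix x assume "x \<in> topspace Y"
    then have "filterlim f (nhds (f x)) (atin Y x)"
      using Cb_continuous[OF C0_Cb[OF f]] by (simp add: continuous_map_tendsto)
    from filterlim_compose[OF continuous_norm_square_inverse this]
    show "((\<lambda>x. of_real ((norm (f x))\<^sup>2) * inverse (f x)) \<longlongrightarrow> of_real ((norm (f x))\<^sup>2) * inverse (f x)) (atin Y x)" .
  qed
qed (simp add: norm_norm_square_inverse del: of_real_power)

text \<open>Finitely many members of \<open>J\<close> have no common zero on the compact set
  \<open>K\<close> where \<open>f\<close> is not small. The sum \<open>r\<close> of their squared
  moduli lies in \<open>J\<close>, and f * n r / (1 + n r) is a member of \<open>J\<close> that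
  differs from \<open>f\<close> by f / (1 + n r). On \<open>K\<close> a large \<open>n\<close> makes
  this small; off \<open>K\<close> already \<open>f\<close> is small.\<close>

lemma C0_ideal_dense:
  fixes J :: "('a \<Rightarrow> 'k::real_normed_field) set"
  assumes J: "J \<subseteq> C0 Y" "(\<lambda>x. 0) \<in> J" "\<And>f g. f \<in> J \<Longrightarrow> g \<in> J \<Longrightarrow> (\<lambda>x. f x + g x) \<in> J"
    "\<And>f g. f \<in> J \<Longrightarrow> g \<in> C0 Y \<Longrightarrow> (\<lambda>x. f x * g x) \<in> J"
    and f: "f \<in> C0 Y" and nz: "\<And>y. y \<in> topspace Y \<Longrightarrow> f y \<noteq> 0 \<Longrightarrow> \<exists>h\<in>J. h y \<noteq> 0"
    and e: "e > 0"
  shows "\<exists>g\<in>J. sup_norm (\<lambda>x. f x - g x) \<le> e"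
proof -
  define K where "K = {y \<in> topspace Y. norm (f y) \<ge> e}"
  have K: "compactin Y K"
    unfolding K_def using f e by (rule C0_compactin)
  have cont: "continuous_map Y euclidean h" if "h \<in> J" for h
    using that J(1) by (intro Cb_continuous C0_Cb) auto
  have "\<exists>\<F>. finite \<F> \<and> \<F> \<subseteq> (\<lambda>h. {y \<in> topspace Y. h y \<noteq> 0}) ` J \<and> K \<subseteq> \<Union>\<F>"
  proof (rule compactinD[OF K])
    show "openin Y U" if "U \<in> (\<lambda>h. {y \<in> topspace Y. h y \<noteq> 0}) ` J" for U
      using that cont openin_continuous_map_preimage[of Y euclidean _ "- {0}"] by auto
    show "K \<subseteq> \<Union> ((\<lambda>h. {y \<in> topspace Y. h y \<noteq> 0}) ` J)"
    proof
      fix y assume "y \<in> K"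
      then have "y \<in> topspace Y" "f y \<noteq> 0"
        using e by (auto simp: K_def)
      with nz show "y \<in> \<Union> ((\<lambda>h. {y \<in> topspace Y. h y \<noteq> 0}) ` J)"
        by blast
    qed
  qed
  then obtain \<F> where \<F>: "finite \<F>" "\<F> \<subseteq> (\<lambda>h. {y \<in> topspace Y. h y \<noteq> 0}) ` J" "K \<subseteq> \<Union>\<F>"
    by blast
  from finite_subset_image[OF \<F>(1,2)]
  obtain F where F: "finite F" "F \<subseteq> J" "\<F> = (\<lambda>h. {y \<in> topspace Y. h y \<noteq> 0}) ` F"
    by blast
  define r where "r = (\<lambda>y. \<Sum>h\<in>F. (norm (h y))\<^sup>2)"
  have r0: "r y \<ge> 0" for y
    by (simp add: r_def sum_nonneg)
  \<comment> \<open>Each squared modulus is \<open>h\<close> times its substitute conjugate, hence a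
    product of a member of \<open>J\<close> with a member of \<open>C0 Y\<close>.\<close>
  have "(\<lambda>x. \<Sum>h\<in>F. h x * (of_real ((norm (h x))\<^sup>2) * inverse (h x))) \<in> J"
  proof (rule C0_ideal_sum[OF J(2,3) F(1)])
    fix h assume "h \<in> F"
    then show "(\<lambda>x. h x * (of_real ((norm (h x))\<^sup>2) * inverse (h x))) \<in> J"
      using F(2) J(1) by (intro J(4) C0_norm_square_inverse) auto
  qed
  also have "(\<lambda>x. \<Sum>h\<in>F. h x * (of_real ((norm (h x))\<^sup>2) * inverse (h x))) = (\<lambda>x. of_real (r x))"
    unfolding r_def of_real_sum by (intro ext sum.cong) (auto simp: field_simps)
  finally have rJ: "(\<lambda>x. of_real (r x)) \<in> J" .
  have rc: "continuous_map Y euclideanreal r"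
    using cont F(2) unfolding r_def continuous_map_tendsto by (auto intro!: tendsto_intros)
  have "compact (r ` K)"
    using image_compactin[OF K rc] by simp
  moreover have "r y > 0" if "y \<in> K" for y
  proof -
    obtain h where "h \<in> F" "h y \<noteq> 0"
      using F(3) \<F>(3) \<open>y \<in> K\<close> by blast
    then show ?thesis
      unfolding r_def by (intro sum_pos2[OF F(1)]) auto
  qed
  \<comment> \<open>\<open>d\<close> is the minimum of \<open>r\<close> on \<open>K\<close>; for
    empty \<open>K\<close> any positive number serves.\<close>
  ultimately obtain d where d: "d > 0" "\<And>y. y \<in> K \<Longrightarrow> d \<le> r y"
    using compact_attains_inf[of "r ` K"] by (cases "K = {}") (auto intro: zero_less_one)
  define B where "B = sup_norm f"
  have fB: "norm (f y) \<le> B" for y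
    unfolding B_def using f by (intro Cb_norm_le C0_Cb)
  \<comment> \<open>This choice makes B < e n d, so that the error B / (1 + n d) on \<open>K\<close>
    stays below \<open>e\<close>.\<close>
  obtain n :: nat where n: "B / (e * d) < real n"
    using reals_Archimedean2 by blast
  \<comment> \<open>The approximant is split as \<open>r\<close> times \<open>k\<close>, with
    \<open>r\<close> in \<open>J\<close> and \<open>k\<close> in \<open>C0 Y\<close>, to apply the
    ideal property. The factor in front of \<open>f\<close> is at most \<open>n\<close>.\<close>
  define k where "k = (\<lambda>y. of_real (n / (1 + n * r y)) * f y)"
  have pos: "1 + n * r y > 0" for y
    using r0[of y] by (simp add: add_pos_nonneg)
  have kC: "k \<in> C0 Y"
  proof (rule C0_dominated[OF f, where B = n])
    have "1 + n * r y \<noteq> 0" for y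
      using pos[of y] by simp
    then show "continuous_map Y euclidean k"
      using Cb_continuous[OF C0_Cb[OF f]] rc unfolding k_def continuous_map_tendsto
      by (auto intro!: tendsto_intros simp del: of_real_divide)
    have "\<bar>n / (1 + n * r y)\<bar> \<le> n" for y
      using pos[of y] r0[of y] by (simp add: pos_divide_le_eq distrib_left)
    then show "norm (k y) \<le> n * norm (f y)" for y
      unfolding k_def norm_mult norm_of_real by (intro mult_right_mono) auto
  qed
  have "norm (f y - of_real (r y) * k y) \<le> e" for y
  proof -
    have "f y - of_real (r y) * k y = of_real (1 - r y * (n / (1 + n * r y))) * f y"
      by (simp add: k_def algebra_simps)
    also have "1 - r y * (n / (1 + n * r y)) = 1 / (1 + n * r y)"
      using pos[of y] by (simp add: field_simps)
    finally have eq: "norm (f y - of_real (r y) * k y) = norm (f y) / (1 + n * r y)"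
      using pos[of y] by (simp add: norm_mult norm_divide del: of_real_add)
    have "norm (f y) \<le> e * (1 + n * r y)"
    proof (cases "y \<in> K")
      case True
      have "B \<le> e * (n * d)"
        using n e d by (simp add: pos_divide_less_eq algebra_simps)
      also have "\<dots> \<le> e * (1 + n * r y)"
        using d(2)[OF True] e mult_left_mono[of d "r y" n] by (intro mult_left_mono) auto
      finally show ?thesis using fB[of y] by linarith
    next
      case False
      then have "norm (f y) \<le> e"
        using e Cb_outside[OF C0_Cb[OF f]] by (cases "y \<in> topspace Y") (auto simp: K_def)
      also have "e * 1 \<le> e * (1 + n * r y)"
        using e r0[of y] by (intro mult_left_mono) auto
      finally show ?thesis by simp
    qed
    then show ?thesis
      unfolding eq using pos[of y] by (simp add: pos_divide_le_eq)
  qed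
  then have "sup_norm (\<lambda>y. f y - of_real (r y) * k y) \<le> e"
    by (rule sup_norm_le)
  with J(4)[OF rJ kC] show ?thesis
    by (intro bexI[of _ "\<lambda>y. of_real (r y) * k y"])
qed

text \<open>Let \<open>u\<close> have value 1 under \<xi>. Were the kernel without common zero where
  \<open>u\<close> is nonzero, it would contain some \<open>g\<close> within 1/2 of
  \<open>u\<close>, against contractivity. At a common zero \<open>y\<close> with \<open>u y\<close>
  nonzero, \<xi> is evaluation up to the factor \<open>u y\<close>, and multiplicativity makes this
  factor 1.\<close>

lemma C0_character_evaluation:
  fixes \<xi> :: "('a \<Rightarrow> 'k::real_normed_field) \<Rightarrow> 'k"
  assumes add: "\<And>f g. f \<in> C0 Y \<Longrightarrow> g \<in> C0 Y \<Longrightarrow> \<xi> (\<lambda>x. f x + g x) = \<xi> f + \<xi> g"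
    and scale: "\<And>c f. f \<in> C0 Y \<Longrightarrow> \<xi> (\<lambda>x. c * f x) = c * \<xi> f"
    and mult: "\<And>f g. f \<in> C0 Y \<Longrightarrow> g \<in> C0 Y \<Longrightarrow> \<xi> (\<lambda>x. f x * g x) = \<xi> f * \<xi> g"
    and bound: "\<And>f. f \<in> C0 Y \<Longrightarrow> norm (\<xi> f) \<le> sup_norm f"
    and nz: "\<exists>f\<in>C0 Y. \<xi> f \<noteq> 0"
  obtains y where "y \<in> topspace Y" "\<And>f. f \<in> C0 Y \<Longrightarrow> \<xi> f = f y"
proof -
  have minus: "\<xi> (\<lambda>x. f x - g x) = \<xi> f - \<xi> g" if "f \<in> C0 Y" "g \<in> C0 Y" for f g
    using add[OF that(1) C0_scale[OF that(2), of "-1"]] scale[OF that(2), of "-1"] by simp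
  obtain u where u: "u \<in> C0 Y" "\<xi> u = 1"
  proof -
    obtain f where f: "f \<in> C0 Y" "\<xi> f \<noteq> 0"
      using nz by blast
    show thesis
      by (rule that[of "\<lambda>x. inverse (\<xi> f) * f x"]) (use f in \<open>simp_all add: C0_scale scale\<close>)
  qed
  define J where "J = {f \<in> C0 Y. \<xi> f = 0}"
  have "\<exists>y\<in>topspace Y. u y \<noteq> 0 \<and> (\<forall>f\<in>J. f y = 0)"
  proof (rule ccontr)
    assume "\<not> ?thesis"
    then have nz': "\<exists>f\<in>J. f y \<noteq> 0" if "y \<in> topspace Y" "u y \<noteq> 0" for y
      using that by blast
    have zero: "\<xi> (\<lambda>x. 0) = 0"
      using scale[OF C0_zero, of 0] by simp
    have "\<exists>g\<in>J. sup_norm (\<lambda>x. u x - g x) \<le> 1/2"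
      by (rule C0_ideal_dense[where Y = Y])
        (use nz' zero u in \<open>auto simp: J_def C0_zero C0_add C0_mult C0_Cb add mult\<close>)
    then obtain g where g: "g \<in> C0 Y" "\<xi> g = 0" "sup_norm (\<lambda>x. u x - g x) \<le> 1/2"
      by (auto simp: J_def)
    have "norm (\<xi> (\<lambda>x. u x - g x)) \<le> 1/2"
      using bound[OF C0_minus[OF u(1) g(1)]] g(3) by linarith
    then show False
      using u g by (simp add: minus)
  qed
  then obtain y where y: "y \<in> topspace Y" "u y \<noteq> 0" "\<And>f. f \<in> C0 Y \<Longrightarrow> \<xi> f = 0 \<Longrightarrow> f y = 0"
    by (auto simp: J_def)
  \<comment> \<open>The function f - \<xi>(f) u lies in the kernel and so vanishes at
    \<open>y\<close>.\<close>
  have eq: "f y = \<xi> f * u y" if f: "f \<in> C0 Y" for f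
    using y(3)[of "\<lambda>x. f x - \<xi> f * u x"] f u by (simp add: C0_minus C0_scale minus scale)
  \<comment> \<open>This is \<open>eq\<close> for the square of \<open>u\<close>, whose value under
    \<xi> is again 1.\<close>
  have "u y * u y = u y"
    using eq[OF C0_mult[OF u(1) C0_Cb[OF u(1)]]] u by (simp add: mult)
  then have "u y = 1"
    using y(2) by simp
  then show thesis
    using that[OF y(1)] eq by simp
qed

section \<open>The Banach-Stone theorem\<close>

text \<open>The map is a parameter here, so that specific isomorphisms can be inverted and
  composed.\<close>

definition isometric_isomorphism ::
    "(('a \<Rightarrow> 'k::real_normed_field) \<Rightarrow> ('b \<Rightarrow> 'k)) \<Rightarrow> ('a \<Rightarrow> 'k) set \<Rightarrow> ('b \<Rightarrow> 'k) set \<Rightarrow> bool" where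
  "isometric_isomorphism T A B \<longleftrightarrow>
     bij_betw T A B \<and>
     (\<forall>f\<in>A. \<forall>g\<in>A. T (\<lambda>x. f x + g x) = (\<lambda>y. T f y + T g y)) \<and>
     (\<forall>c. \<forall>f\<in>A. T (\<lambda>x. c * f x) = (\<lambda>y. c * T f y)) \<and>
     (\<forall>f\<in>A. \<forall>g\<in>A. T (\<lambda>x. f x * g x) = (\<lambda>y. T f y * T g y)) \<and>
     (\<forall>f\<in>A. sup_norm (T f) = sup_norm f)"

lemma isometrically_isomorphic_iff:
  "isometrically_isomorphic A B \<longleftrightarrow> (\<exists>T. isometric_isomorphism T A B)"
  by (simp add: isometrically_isomorphic_def isometric_isomorphism_def)

text \<open>Closure of \<open>A\<close> under the operations places the sums and products in the set
  on which \<open>inv_into A T\<close> undoes \<open>T\<close>.\<close>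

lemma isometric_isomorphism_inverse:
  assumes T: "isometric_isomorphism T A B"
    and A: "\<And>f g. f \<in> A \<Longrightarrow> g \<in> A \<Longrightarrow> (\<lambda>x. f x + g x) \<in> A" "\<And>c f. f \<in> A \<Longrightarrow> (\<lambda>x. c * f x) \<in> A"
      "\<And>f g. f \<in> A \<Longrightarrow> g \<in> A \<Longrightarrow> (\<lambda>x. f x * g x) \<in> A"
  shows "isometric_isomorphism (inv_into A T) B A"
proof -
  let ?S = "inv_into A T"
  have bij: "bij_betw T A B"
    using T by (simp add: isometric_isomorphism_def)
  have inv: "?S (T f) = f" if "f \<in> A" for f
    using bij that by (simp add: bij_betw_inv_into_left)
  have B: "B = T ` A"
    using bij by (simp add: bij_betw_imp_surj_on)
  have "?S (\<lambda>y. T f y + T g y) = (\<lambda>x. f x + g x)" if "f \<in> A" "g \<in> A" for f g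
    using inv[OF A(1)[OF that]] that T unfolding isometric_isomorphism_def by metis
  moreover have "?S (\<lambda>y. c * T f y) = (\<lambda>x. c * f x)" if "f \<in> A" for c f
    using inv[OF A(2)[OF that]] that T unfolding isometric_isomorphism_def by metis
  moreover have "?S (\<lambda>y. T f y * T g y) = (\<lambda>x. f x * g x)" if "f \<in> A" "g \<in> A" for f g
    using inv[OF A(3)[OF that]] that T unfolding isometric_isomorphism_def by metis
  moreover have "sup_norm (T f) = sup_norm f" if "f \<in> A" for f
    using that T unfolding isometric_isomorphism_def by blast
  ultimately show ?thesis
    using bij_betw_inv_into[OF bij] unfolding isometric_isomorphism_def B by (simp add: inv)
qed

lemma isometric_isomorphism_compose:
  assumes T: "isometric_isomorphism T A B" and S: "isometric_isomorphism S B C"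
  shows "isometric_isomorphism (S \<circ> T) A C"
proof -
  have "T f \<in> B" if "f \<in> A" for f
    using T that unfolding isometric_isomorphism_def by (blast dest: bij_betwE)
  moreover have "bij_betw (S \<circ> T) A C"
    using T S unfolding isometric_isomorphism_def by (blast intro: bij_betw_trans)
  ultimately show ?thesis
    using T S unfolding isometric_isomorphism_def by simp
qed

text \<open>For fixed \<open>z\<close>, the map sending \<open>f\<close> to \<open>T f z\<close> is
  a contractive character, nonzero because \<open>T\<close> is onto and some member of
  \<open>C0 Z\<close> is 1 at \<open>z\<close>. It is therefore evaluation at a point
  \<tau>(z).\<close>

lemma C0_isomorphism_composition:
  fixes T :: "('a \<Rightarrow> 'k::real_normed_field) \<Rightarrow> ('b \<Rightarrow> 'k)"
  assumes Y: "locally_compact_space Y" "Hausdorff_space Y"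
    and Z: "locally_compact_space Z" "Hausdorff_space Z"
    and T: "isometric_isomorphism T (C0 Y) (C0 Z)"
  obtains \<tau> where "continuous_map Z Y \<tau>" "\<And>f z. f \<in> C0 Y \<Longrightarrow> z \<in> topspace Z \<Longrightarrow> T f z = f (\<tau> z)"
proof -
  have surj: "T ` C0 Y = C0 Z"
    using T by (simp add: isometric_isomorphism_def bij_betw_def)
  have "\<exists>y\<in>topspace Y. \<forall>f\<in>C0 Y. T f z = f y" if z: "z \<in> topspace Z" for z
  proof -
    obtain g :: "'b \<Rightarrow> 'k" where g: "g \<in> C0 Z" "g z = 1"
      using C0_urysohn[OF Z openin_topspace z] by blast
    have bound: "norm (T f z) \<le> sup_norm f" if "f \<in> C0 Y" for f
      using Cb_norm_le[OF C0_Cb, of "T f" Z z] surj T that unfolding isometric_isomorphism_def by auto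
    have nz: "\<exists>f\<in>C0 Y. T f z \<noteq> 0"
      using g surj by (metis imageE zero_neq_one)
    obtain y where "y \<in> topspace Y" "\<And>f. f \<in> C0 Y \<Longrightarrow> T f z = f y"
      by (rule C0_character_evaluation[of Y "\<lambda>f. T f z"])
        (use T bound nz in \<open>auto simp: isometric_isomorphism_def\<close>)
    then show ?thesis by blast
  qed
  then obtain \<tau> where \<tau>: "\<And>z. z \<in> topspace Z \<Longrightarrow> \<tau> z \<in> topspace Y"
    "\<And>f z. f \<in> C0 Y \<Longrightarrow> z \<in> topspace Z \<Longrightarrow> T f z = f (\<tau> z)"
    by metis
  \<comment> \<open>Continuity of \<tau>: for \<open>f\<close> vanishing off \<open>U\<close>, the
    set where \<open>T f\<close> is nonzero is open and lies in the preimage of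
    \<open>U\<close>.\<close>
  have "openin Z {z \<in> topspace Z. \<tau> z \<in> U}" if U: "openin Y U" for U
  proof (subst openin_subopen, intro ballI)
    fix z assume z: "z \<in> {z \<in> topspace Z. \<tau> z \<in> U}"
    then obtain f :: "'a \<Rightarrow> 'k" where f: "f \<in> C0 Y" "f (\<tau> z) = 1" "\<And>y. y \<notin> U \<Longrightarrow> f y = 0"
      using C0_urysohn[OF Y U, of "\<tau> z"] by blast
    let ?V = "{z \<in> topspace Z. T f z \<in> - {0}}"
    have "continuous_map Z euclidean (T f)"
      using surj f(1) by (blast intro: Cb_continuous C0_Cb)
    then have "openin Z ?V"
      by (rule openin_continuous_map_preimage) auto
    moreover have "z \<in> ?V"
      using z f \<tau>(2) by simp
    moreover have "?V \<subseteq> {z \<in> topspace Z. \<tau> z \<in> U}"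
    proof
      fix z' assume "z' \<in> ?V"
      then have "z' \<in> topspace Z" "f (\<tau> z') \<noteq> 0"
        using \<tau>(2)[OF f(1)] by auto
      with f(3) show "z' \<in> {z \<in> topspace Z. \<tau> z \<in> U}"
        by blast
    qed
    ultimately show "\<exists>V. openin Z V \<and> z \<in> V \<and> V \<subseteq> {z \<in> topspace Z. \<tau> z \<in> U}"
      by blast
  qed
  then have "continuous_map Z Y \<tau>"
    using \<tau>(1) by (auto simp: continuous_map_def)
  then show thesis
    using that \<tau>(2) by blast
qed

text \<open>A Urysohn function at \<open>y\<close> for the complement of \<open>x\<close> tells the
  two apart. This covers an \<open>x\<close> outside the space, where members of \<open>C0 Y\<close>
  are 0.\<close>

lemma C0_separates_points:
  assumes Y: "locally_compact_space Y" "Hausdorff_space Y" and "y \<in> topspace Y"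
    and eq: "\<And>f :: 'a \<Rightarrow> 'k::real_normed_field. f \<in> C0 Y \<Longrightarrow> f x = f y"
  shows "x = y"
proof (rule ccontr)
  assume "x \<noteq> y"
  have "openin Y (topspace Y - {x})"
    using Y(2) by (metis Diff_empty Diff_insert0 closedin_Hausdorff_singleton openin_diff openin_topspace)
  then obtain f :: "'a \<Rightarrow> 'k" where "f \<in> C0 Y" "f y = 1" "f x = 0"
    using C0_urysohn[OF Y, of "topspace Y - {x}" y] \<open>x \<noteq> y\<close> \<open>y \<in> topspace Y\<close> by blast
  then show False
    using eq[of f] by simp
qed

text \<open>\<open>T\<close> and its inverse are compositions with continuous maps \<tau> and
  \<sigma>. Since f(\<tau>(\<sigma>(y))) = (T f)(\<sigma>(y)) = f(y) for all \<open>f\<close>, and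
  symmetrically, separation of points makes \<tau> and \<sigma> mutually inverse.\<close>

theorem Banach_Stone_C0:
  fixes T :: "('a \<Rightarrow> 'k::real_normed_field) \<Rightarrow> ('b \<Rightarrow> 'k)"
  assumes Y: "locally_compact_space Y" "Hausdorff_space Y"
    and Z: "locally_compact_space Z" "Hausdorff_space Z"
    and T: "isometric_isomorphism T (C0 Y) (C0 Z)"
  shows "Y homeomorphic_space Z"
proof -
  define S where "S = inv_into (C0 Y) T"
  have S: "isometric_isomorphism S (C0 Z) (C0 Y)"
    unfolding S_def using T
    by (rule isometric_isomorphism_inverse) (simp_all add: C0_add C0_scale C0_mult C0_Cb)
  have bij: "bij_betw T (C0 Y) (C0 Z)"
    using T by (simp add: isometric_isomorphism_def)
  obtain \<tau> where \<tau>: "continuous_map Z Y \<tau>" "\<And>f z. f \<in> C0 Y \<Longrightarrow> z \<in> topspace Z \<Longrightarrow> T f z = f (\<tau> z)"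
    using C0_isomorphism_composition[OF Y Z T] by blast
  obtain \<sigma> where \<sigma>: "continuous_map Y Z \<sigma>" "\<And>g y. g \<in> C0 Z \<Longrightarrow> y \<in> topspace Y \<Longrightarrow> S g y = g (\<sigma> y)"
    using C0_isomorphism_composition[OF Z Y S] by blast
  have "\<tau> (\<sigma> y) = y" if y: "y \<in> topspace Y" for y
  proof (rule C0_separates_points[OF Y y])
    fix f :: "'a \<Rightarrow> 'k" assume f: "f \<in> C0 Y"
    have "\<sigma> y \<in> topspace Z" "T f \<in> C0 Z" "S (T f) = f"
      using \<sigma>(1) y bij f unfolding S_def
      by (auto simp: continuous_map_def bij_betw_inv_into_left bij_betw_apply)
    then show "f (\<tau> (\<sigma> y)) = f y"
      using \<tau>(2)[OF f] \<sigma>(2)[of "T f" y] y by simp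
  qed
  moreover have "\<sigma> (\<tau> z) = z" if z: "z \<in> topspace Z" for z
  proof (rule C0_separates_points[OF Z z])
    fix g :: "'b \<Rightarrow> 'k" assume g: "g \<in> C0 Z"
    have "\<tau> z \<in> topspace Y" "S g \<in> C0 Y" "T (S g) = g"
      using \<tau>(1) z bij g bij_betw_inv_into[OF bij] unfolding S_def
      by (auto simp: continuous_map_def bij_betw_inv_into_right bij_betw_apply)
    then show "g (\<sigma> (\<tau> z)) = g z"
      using \<sigma>(2)[OF g] \<tau>(2)[of "S g" z] z by simp
  qed
  ultimately show ?thesis
    using \<sigma>(1) \<tau>(1) unfolding homeomorphic_space_def homeomorphic_maps_def by blast
qed

section \<open>Restriction from the Stone-Cech compactification\<close>

text \<open>By the Heine-Borel property a bounded \<open>f\<close> takes values in a compact ball,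
  to which the universal property of \<open>beta X\<close> applies.\<close>

lemma Cb_beta_extension:
  fixes f :: "'a \<Rightarrow> 'k::{real_normed_field,heine_borel}"
  assumes f: "f \<in> Cb X"
  obtains F where "continuous_map (beta X) euclidean F" "\<And>x. x \<in> topspace X \<Longrightarrow> F (beta_embed X x) = f x"
proof -
  let ?Z = "top_of_set (cball (0::'k) (sup_norm f))"
  have "compact_space ?Z"
    by (intro compact_space_subtopology) simp
  moreover have "Hausdorff_space ?Z"
    by (simp add: Hausdorff_space_subtopology)
  moreover have "continuous_map X ?Z f"
    using Cb_continuous[OF f] Cb_norm_le[OF f] by (auto simp: continuous_map_in_subtopology)
  ultimately obtain F where "continuous_map (beta X) ?Z F" "\<forall>x\<in>topspace X. F (beta_embed X x) = f x"
    using beta_extension[of ?Z X f] by blast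
  then show thesis
    using that by (auto simp: continuous_map_in_subtopology)
qed

lemma continuous_map_beta_embed: "continuous_map X (beta X) (beta_embed X)"
  using beta_embed_subset[of X]
  by (simp add: beta_def continuous_map_in_subtopology continuous_map_beta_embed_cube image_subset_iff_funcset)

lemma beta_embed_in_beta: "x \<in> topspace X \<Longrightarrow> beta_embed X x \<in> topspace (beta X)"
  using continuous_map_beta_embed[of X] by (auto simp: continuous_map_def)

lemma beta_dense:
  assumes "openin (beta X) U" "p \<in> U"
  obtains x where "x \<in> topspace X" "beta_embed X x \<in> U"
  using dense_beta_embed[of X] assms unfolding dense_intersects_open by blast

text \<open>\<open>X\<close> carries the topology induced from \<open>beta X\<close>, so closures in
  \<open>X\<close> are traces of closures in \<open>beta X\<close>.\<close>

lemma beta_closure_embed: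
  assumes X: "completely_regular_space X" "Hausdorff_space X"
    and x: "x \<in> topspace X" and S: "S \<subseteq> topspace X" "beta_embed X x \<in> beta X closure_of (beta_embed X ` S)"
  shows "x \<in> X closure_of S"
proof -
  have hom: "homeomorphic_map X (subtopology (beta X) (beta_embed X ` topspace X)) (beta_embed X)"
    using embedding_map_beta_embed[OF X] by (simp add: embedding_map_def)
  have "beta_embed X x \<in> beta_embed X ` (X closure_of S)"
    using homeomorphic_map_closure_of[OF hom S(1)] imageI[OF x, of "beta_embed X"] S
    by (auto simp: closure_of_subtopology Int_absorb1 image_mono)
  then show ?thesis
    using homeomorphic_imp_injective_map[OF hom] x closure_of_subset_topspace[of X S]
    by (metis (no_types, lifting) imageE inj_onD subsetD)
qed

locale support_ideal =
  fixes X :: "'a topology" and H :: "('a \<Rightarrow> 'k::{real_normed_field,heine_borel}) set"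
  assumes X: "completely_regular_space X" "Hausdorff_space X"
    and H: "banach_subalgebra X H"
    and nonvanishing: "\<forall>x\<in>topspace X. \<exists>h\<in>H. h x \<noteq> 0"
    and support: "\<forall>f\<in>Cb X. (\<exists>h\<in>H. supp X f \<subseteq> supp X h) \<longrightarrow> f \<in> H"
begin

abbreviation (input) "e \<equiv> beta_embed X"
abbreviation (input) "\<Lambda> \<equiv> lambda_space X H"

text \<open>Pullback along the embedding, set to 0 off \<open>X\<close> to match the convention for
  \<open>Cb X\<close>. It runs from \<open>C0\<close> of the lambda space to \<open>H\<close>, the
  direction that has an explicit formula.\<close>

definition restriction :: "((('a \<Rightarrow> real) \<Rightarrow> real) \<Rightarrow> 'k) \<Rightarrow> 'a \<Rightarrow> 'k" where
  "restriction g = (\<lambda>x. if x \<in> topspace X then g (e x) else 0)"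

lemma H_Cb: "h \<in> H \<Longrightarrow> h \<in> Cb X"
  using H unfolding banach_subalgebra_def by blast

lemma H_zero: "(\<lambda>x. 0) \<in> H"
  using H by (simp add: banach_subalgebra_def)

lemma H_add: "f \<in> H \<Longrightarrow> g \<in> H \<Longrightarrow> (\<lambda>x. f x + g x) \<in> H"
  using H by (simp add: banach_subalgebra_def)

lemma H_support: "f \<in> Cb X \<Longrightarrow> h \<in> H \<Longrightarrow> supp X f \<subseteq> supp X h \<Longrightarrow> f \<in> H"
  using support by blast

lemma H_closed:
  assumes "f \<in> Cb X" "\<And>d. d > 0 \<Longrightarrow> \<exists>h\<in>H. sup_norm (\<lambda>x. f x - h x) < d"
  shows "f \<in> H"
proof -
  have "\<forall>f\<in>Cb X. (\<forall>e>0. \<exists>h\<in>H. sup_norm (\<lambda>x. f x - h x) < e) \<longrightarrow> f \<in> H"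
    using H by (simp add: banach_subalgebra_def)
  with assms show ?thesis by simp
qed

section \<open>The lambda space as a subspace of the Stone-Cech compactification\<close>

lemma lambda_set_subset: "lambda_set X H \<subseteq> topspace (beta X)"
  unfolding lambda_set_def by (intro UN_least interior_of_subset_topspace)

lemma topspace_lambda: "topspace \<Lambda> = lambda_set X H"
  using lambda_set_subset by (simp add: lambda_space_def Int_absorb1)

lemma openin_lambda_set: "openin (beta X) (lambda_set X H)"
  unfolding lambda_set_def by (intro openin_Union) auto

lemma openin_lambda_space: "openin \<Lambda> U \<longleftrightarrow> openin (beta X) U \<and> U \<subseteq> lambda_set X H"
  unfolding lambda_space_def using openin_lambda_set by (rule openin_open_subtopology)

lemma Hausdorff_lambda_space: "Hausdorff_space \<Lambda>"
  by (simp add: lambda_space_def Hausdorff_space_beta Hausdorff_space_subtopology)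

lemma locally_compact_lambda_space: "locally_compact_space \<Lambda>"
  unfolding lambda_space_def
  by (intro locally_compact_space_open_subset openin_lambda_set)
    (simp_all add: Hausdorff_space_beta compact_space_beta compact_imp_locally_compact_space)

text \<open>The set where \<open>F\<close> is nonzero is open, and by density of \<open>X\<close>
  each of its points is a limit of points of \<open>Coz X f\<close>. An open subset of a closure
  lies in its interior.\<close>

lemma nonzero_in_lambda_set:
  assumes f: "f \<in> H" and F: "continuous_map (beta X) euclidean F" "\<And>x. x \<in> topspace X \<Longrightarrow> F (e x) = f x"
    and p: "p \<in> topspace (beta X)" "F p \<noteq> 0"
  shows "p \<in> lambda_set X H"
proof -
  let ?U = "{q \<in> topspace (beta X). F q \<in> - {0}}"
  have U: "openin (beta X) ?U"
    using F(1) by (rule openin_continuous_map_preimage) auto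
  have "?U \<subseteq> beta X closure_of (e ` Coz X f)"
  proof
    fix q assume q: "q \<in> ?U"
    have "\<exists>y\<in>e ` Coz X f. y \<in> T" if T: "openin (beta X) T" "q \<in> T" for T
    proof -
      obtain x where "x \<in> topspace X" "e x \<in> ?U \<inter> T"
        using beta_dense[OF openin_Int[OF U T(1)]] q T(2) by blast
      then show ?thesis
        using F(2) by (auto simp: Coz_def)
    qed
    then show "q \<in> beta X closure_of (e ` Coz X f)"
      using q by (auto simp: in_closure_of)
  qed
  then have "?U \<subseteq> beta X interior_of (beta X closure_of (e ` Coz X f))"
    using U by (rule interior_of_maximal)
  then show ?thesis
    using f p unfolding lambda_set_def by blast
qed

lemma beta_embed_in_lambda_set:
  assumes x: "x \<in> topspace X"
  shows "e x \<in> lambda_set X H"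
proof -
  obtain h where h: "h \<in> H" "h x \<noteq> 0"
    using nonvanishing x by blast
  obtain F where "continuous_map (beta X) euclidean F" "\<And>x. x \<in> topspace X \<Longrightarrow> F (e x) = h x"
    using Cb_beta_extension[OF H_Cb[OF h(1)]] by blast
  then show ?thesis
    using nonzero_in_lambda_set[OF h(1)] h(2) x beta_embed_in_beta by metis
qed

lemma continuous_map_beta_embed_lambda: "continuous_map X \<Lambda> e"
  by (simp add: lambda_space_def continuous_map_in_subtopology continuous_map_beta_embed
      beta_embed_in_lambda_set)

section \<open>Restriction as an isometric isomorphism onto \<open>H\<close>\<close>

lemma restriction_Cb:
  assumes g: "g \<in> Cb \<Lambda>"
  shows "restriction g \<in> Cb X"
proof (rule CbI)
  show "continuous_map X euclidean (restriction g)"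
    using continuous_map_compose[OF continuous_map_beta_embed_lambda Cb_continuous[OF g]]
    by (rule continuous_map_eq) (simp add: restriction_def)
  show "norm (restriction g x) \<le> sup_norm g" if "x \<in> topspace X" for x
    using that Cb_norm_le[OF g] by (simp add: restriction_def)
qed (simp add: restriction_def)

text \<open>A value of \<open>g\<close> with norm above the supremum over \<open>X\<close> would
  give a nonempty set of such points, open in \<open>beta X\<close> because the lambda set is open.
  By density it would contain a point of \<open>X\<close>.\<close>

lemma sup_norm_restriction:
  assumes g: "g \<in> Cb \<Lambda>"
  shows "sup_norm (restriction g) = sup_norm g"
proof (rule antisym)
  have "norm (restriction g x) \<le> sup_norm g" for x
    using Cb_norm_le[OF g] order_trans[OF norm_ge_zero Cb_norm_le[OF g]] by (simp add: restriction_def)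
  then show "sup_norm (restriction g) \<le> sup_norm g"
    by (rule sup_norm_le)
  let ?B = "sup_norm (restriction g)"
  have le: "norm (restriction g x) \<le> ?B" for x
    by (rule Cb_norm_le[OF restriction_Cb[OF g]])
  have "norm (g p) \<le> ?B" for p
  proof (rule ccontr)
    assume p: "\<not> norm (g p) \<le> ?B"
    then have "g p \<noteq> 0"
      using order_trans[OF norm_ge_zero le] by auto
    then have "p \<in> topspace \<Lambda>"
      using Cb_outside[OF g] by blast
    moreover have "openin \<Lambda> {q \<in> topspace \<Lambda>. g q \<in> {a. norm a > ?B}}"
      by (rule openin_continuous_map_preimage[OF Cb_continuous[OF g]])
        (simp add: open_Collect_less continuous_intros)
    ultimately obtain x where "x \<in> topspace X" "norm (g (e x)) > ?B"
      using p unfolding openin_lambda_space by (auto elim!: beta_dense[where p = p])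
    then show False
      using le[of x] by (simp add: restriction_def)
  qed
  then show "sup_norm g \<le> ?B"
    by (rule sup_norm_le)
qed

lemma restriction_in_H:
  assumes g: "g \<in> C0 \<Lambda>"
  shows "restriction g \<in> H"
proof -
  define J where "J = {g \<in> C0 \<Lambda>. restriction g \<in> H}"
  have add: "(\<lambda>x. f x + k x) \<in> J" if "f \<in> J" "k \<in> J" for f k
  proof -
    have "restriction (\<lambda>x. f x + k x) = (\<lambda>x. restriction f x + restriction k x)"
      by (auto simp: restriction_def)
    then show ?thesis
      using that by (simp add: J_def C0_add H_add)
  qed
  have mult: "(\<lambda>x. f x * k x) \<in> J" if "f \<in> J" "k \<in> C0 \<Lambda>" for f k
  proof -
    have fk: "(\<lambda>x. f x * k x) \<in> C0 \<Lambda>"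
      using that by (auto simp: J_def C0_mult C0_Cb)
    \<comment> \<open>A product vanishes wherever its factor \<open>f\<close> does, so the support
      condition on \<open>H\<close> makes \<open>J\<close> an ideal.\<close>
    moreover have "supp X (restriction (\<lambda>x. f x * k x)) \<subseteq> supp X (restriction f)"
      unfolding supp_def by (rule closure_of_mono) (auto simp: Coz_def restriction_def)
    ultimately show ?thesis
      using that(1) H_support[OF restriction_Cb[OF C0_Cb[OF fk]], of "restriction f"] by (simp add: J_def)
  qed
  have zero: "(\<lambda>x. 0) \<in> J"
  proof -
    have "restriction (\<lambda>x. 0) = (\<lambda>x. 0)"
      by (auto simp: restriction_def)
    then show ?thesis
      by (simp add: J_def C0_zero H_zero)
  qed
  have nz: "\<exists>k\<in>J. k p \<noteq> 0" if p: "p \<in> topspace \<Lambda>" for p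
  proof -
    obtain h where h: "h \<in> H" "p \<in> beta X interior_of (beta X closure_of (e ` Coz X h))"
      using p unfolding topspace_lambda lambda_set_def by blast
    let ?U = "beta X interior_of (beta X closure_of (e ` Coz X h))"
    have "openin \<Lambda> ?U"
      unfolding openin_lambda_space using h(1) by (auto simp: lambda_set_def)
    then obtain k :: "_ \<Rightarrow> 'k" where k: "k \<in> C0 \<Lambda>" "k p = 1" "\<And>y. y \<notin> ?U \<Longrightarrow> k y = 0"
      using C0_urysohn[OF locally_compact_lambda_space Hausdorff_lambda_space _ h(2)] by blast
    \<comment> \<open>Points of \<open>X\<close> where \<open>k\<close> is nonzero lie in the
      closure of \<open>Coz X h\<close> in \<open>beta X\<close>, hence in its closure in
      \<open>X\<close>. The support condition then puts the restriction of \<open>k\<close> into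
      \<open>H\<close>.\<close>
    have "Coz X (restriction k) \<subseteq> supp X h"
    proof
      fix x assume "x \<in> Coz X (restriction k)"
      then have x: "x \<in> topspace X" "k (e x) \<noteq> 0"
        by (auto simp: Coz_def restriction_def)
      then have "e x \<in> beta X closure_of (e ` Coz X h)"
        using k(3) interior_of_subset by fast
      then show "x \<in> supp X h"
        unfolding supp_def using x(1) by (intro beta_closure_embed[OF X]) (auto simp: Coz_def)
    qed
    then have "supp X (restriction k) \<subseteq> supp X h"
      unfolding supp_def by (rule closure_of_minimal) simp
    then have "restriction k \<in> H"
      using H_support[OF restriction_Cb[OF C0_Cb[OF k(1)]] h(1)] by simp
    then show ?thesis
      using k(1,2) by (intro bexI[of _ k]) (simp_all add: J_def)
  qed
  have "\<exists>h\<in>H. sup_norm (\<lambda>x. restriction g x - h x) < d" if d: "d > 0" for d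
  proof -
    \<comment> \<open>The bound \<open>d/2\<close> turns the weak inequality of the density lemma
      into the strict one that closedness of \<open>H\<close> asks for.\<close>
    obtain k where k: "k \<in> J" "sup_norm (\<lambda>x. g x - k x) \<le> d/2"
    proof -
      have "\<exists>k\<in>J. sup_norm (\<lambda>x. g x - k x) \<le> d/2"
      proof (rule C0_ideal_dense[OF _ zero add mult g])
        show "J \<subseteq> C0 \<Lambda>"
          by (auto simp: J_def)
        show "\<exists>h\<in>J. h y \<noteq> 0" if "y \<in> topspace \<Lambda>" for y
          using nz that .
        show "d/2 > 0"
          using d by simp
      qed
      then show thesis
        using that by blast
    qed
    have "(\<lambda>x. restriction g x - restriction k x) = restriction (\<lambda>x. g x - k x)"
      by (auto simp: restriction_def)
    moreover have "(\<lambda>x. g x - k x) \<in> Cb \<Lambda>"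
      using g k(1) by (intro C0_Cb C0_minus) (auto simp: J_def)
    ultimately have "sup_norm (\<lambda>x. restriction g x - restriction k x) < d"
      using k(2) \<open>d > 0\<close> by (simp add: sup_norm_restriction)
    then show ?thesis
      using k(1) by (auto simp: J_def)
  qed
  then show ?thesis
    using restriction_Cb[OF C0_Cb[OF g]] by (intro H_closed)
qed

text \<open>Extend \<open>f\<close> to \<open>F\<close> on \<open>beta X\<close> and cut
  \<open>F\<close> to the lambda set. For \<open>d > 0\<close> the set where
  \<open>norm (F p) \<ge> d\<close> is closed in a compact space, hence compact, and it lies in the
  lambda set because \<open>F\<close> is nonzero there.\<close>

lemma H_restriction:
  assumes f: "f \<in> H"
  obtains g where "g \<in> C0 \<Lambda>" "restriction g = f"
proof -
  obtain F where F: "continuous_map (beta X) euclidean F" "\<And>x. x \<in> topspace X \<Longrightarrow> F (e x) = f x"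
    using Cb_beta_extension[OF H_Cb[OF f]] by blast
  define g where "g = (\<lambda>p. if p \<in> topspace \<Lambda> then F p else 0)"
  have "continuous_map \<Lambda> euclidean F"
    unfolding lambda_space_def using F(1) by (rule continuous_map_from_subtopology)
  then have gc: "continuous_map \<Lambda> euclidean g"
    by (rule continuous_map_eq) (simp add: g_def)
  have Fc: "continuous_map (beta X) euclideanreal (\<lambda>p. norm (F p))"
    using F(1) by (simp add: continuous_map_tendsto tendsto_norm)
  have K: "compactin \<Lambda> {p \<in> topspace (beta X). norm (F p) \<ge> d}" if "d > 0" for d
  proof -
    have "closedin (beta X) {p \<in> topspace (beta X). norm (F p) \<in> {d..}}"
      by (rule closedin_continuous_map_preimage[OF Fc]) simp
    then have "compactin (beta X) {p \<in> topspace (beta X). norm (F p) \<ge> d}"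
      using closedin_compact_space[OF compact_space_beta] by simp
    moreover have "{p \<in> topspace (beta X). norm (F p) \<ge> d} \<subseteq> lambda_set X H"
    proof
      fix p assume p: "p \<in> {p \<in> topspace (beta X). norm (F p) \<ge> d}"
      then have "F p \<noteq> 0"
        using \<open>d > 0\<close> by auto
      with p show "p \<in> lambda_set X H"
        using nonzero_in_lambda_set[OF f F] by simp
    qed
    ultimately show ?thesis
      unfolding lambda_space_def by (simp add: compactin_subtopology)
  qed
  have "compactin euclideanreal ((\<lambda>p. norm (F p)) ` topspace (beta X))"
    using compact_space_beta Fc unfolding compact_space_def by (rule image_compactin)
  then have "bounded ((\<lambda>p. norm (F p)) ` topspace (beta X))"
    by (simp add: compact_imp_bounded)
  then obtain B where B: "\<And>p. p \<in> topspace (beta X) \<Longrightarrow> norm (F p) \<le> B"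
    unfolding bounded_iff by auto
  have sub: "topspace \<Lambda> \<subseteq> topspace (beta X)"
    using topspace_lambda lambda_set_subset by simp
  have "g \<in> Cb \<Lambda>"
    using gc by (rule CbI[where B = B]) (use B sub in \<open>auto simp: g_def\<close>)
  then have "g \<in> C0 \<Lambda>"
  proof (rule C0I)
    fix d :: real assume "d > 0"
    with K[OF this] show "\<exists>K. compactin \<Lambda> K \<and> (\<forall>y\<in>topspace \<Lambda> - K. norm (g y) < d)"
      using sub by (intro exI[of _ "{p \<in> topspace (beta X). norm (F p) \<ge> d}"]) (auto simp: g_def)
  qed
  moreover have "restriction g = f"
    using F(2) beta_embed_in_lambda_set Cb_outside[OF H_Cb[OF f]]
    by (auto simp: restriction_def g_def topspace_lambda)
  ultimately show thesis by (rule that)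
qed

lemma isometric_isomorphism_restriction: "isometric_isomorphism restriction (C0 \<Lambda>) H"
proof -
  \<comment> \<open>Injectivity comes from the isometry: a difference with zero restriction has norm
    0.\<close>
  have "inj_on restriction (C0 \<Lambda>)"
  proof (rule inj_onI)
    fix f g assume fg: "f \<in> C0 \<Lambda>" "g \<in> C0 \<Lambda>" "restriction f = restriction g"
    have d: "(\<lambda>x. f x - g x) \<in> Cb \<Lambda>"
      using fg by (intro C0_Cb C0_minus)
    have "f (e x) = g (e x)" if "x \<in> topspace X" for x
      using fun_cong[OF fg(3), of x] that by (simp add: restriction_def)
    then have "restriction (\<lambda>x. f x - g x) = (\<lambda>x. 0)"
      by (auto simp: restriction_def)
    then have "sup_norm (\<lambda>x. f x - g x) = 0"
      using sup_norm_restriction[OF d] by (simp add: sup_norm_def)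
    then show "f = g"
      using Cb_norm_le[OF d] by (auto simp: fun_eq_iff)
  qed
  moreover have "restriction ` C0 \<Lambda> = H"
    using restriction_in_H by (blast elim: H_restriction)
  ultimately have "bij_betw restriction (C0 \<Lambda>) H"
    by (simp add: bij_betw_def)
  then show ?thesis
    unfolding isometric_isomorphism_def
    by (auto simp: C0_Cb sup_norm_restriction) (auto simp: restriction_def)
qed

lemma isometric_isomorphism_H_C0: "isometric_isomorphism (inv_into (C0 \<Lambda>) restriction) H (C0 \<Lambda>)"
  using isometric_isomorphism_restriction
  by (rule isometric_isomorphism_inverse) (simp_all add: C0_add C0_scale C0_mult C0_Cb)

section \<open>Unit element and compactness\<close>

lemma unital_iff_one: "unital H \<longleftrightarrow> one_on X \<in> H"
proof
  assume "unital H"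
  then obtain u where u: "u \<in> H" "\<And>h. h \<in> H \<Longrightarrow> (\<lambda>x. u x * h x) = h"
    by (auto simp: unital_def)
  have "u x = one_on X x" for x
  proof (cases "x \<in> topspace X")
    case True
    \<comment> \<open>Cancelling \<open>h x\<close> in \<open>u x * h x = h x\<close> leaves
      \<open>u x = 1\<close>.\<close>
    then obtain h where "h \<in> H" "h x \<noteq> 0"
      using nonvanishing by blast
    then show ?thesis
      using fun_cong[OF u(2), of h x] True by (simp add: one_on_def)
  next
    case False
    then show ?thesis
      using Cb_outside[OF H_Cb[OF u(1)]] by (simp add: one_on_def)
  qed
  then have "u = one_on X" ..
  with u show "one_on X \<in> H" by simp
next
  assume "one_on X \<in> H"
  then show "unital H"
    unfolding unital_def
    by (intro bexI[of _ "one_on X"] ballI) (auto simp: fun_eq_iff one_on_def Cb_outside[OF H_Cb])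
qed

text \<open>The cozero set of the constant 1 is \<open>X\<close>, whose closure is all of
  \<open>beta X\<close>.\<close>

lemma one_imp_lambda_space_eq_beta:
  assumes "one_on X \<in> H"
  shows "\<Lambda> = beta X"
proof -
  have "Coz X (one_on X :: 'a \<Rightarrow> 'k) = topspace X"
    by (auto simp: Coz_def one_on_def)
  then have "beta X interior_of (beta X closure_of (e ` Coz X (one_on X :: 'a \<Rightarrow> 'k))) = topspace (beta X)"
    by (simp add: dense_beta_embed)
  then have "topspace (beta X) \<subseteq> lambda_set X H"
    using assms unfolding lambda_set_def by blast
  then show ?thesis
    unfolding lambda_space_def by (simp add: subtopology_superset)
qed

text \<open>On a compact space the constant 1 vanishes at infinity, and its restriction is the
  constant 1 on \<open>X\<close>.\<close>

lemma compact_lambda_space_imp_one: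
  assumes "compact_space \<Lambda>"
  shows "one_on X \<in> H"
proof -
  have "continuous_map \<Lambda> euclidean (one_on \<Lambda> :: _ \<Rightarrow> 'k)"
    by (rule continuous_map_eq[of _ _ "\<lambda>x. 1"]) (auto simp: one_on_def)
  then have "(one_on \<Lambda> :: _ \<Rightarrow> 'k) \<in> Cb \<Lambda>"
    by (rule CbI[where B = 1]) (auto simp: one_on_def)
  then have "(one_on \<Lambda> :: _ \<Rightarrow> 'k) \<in> C0 \<Lambda>"
    by (rule C0I) (use assms in \<open>auto simp: compact_space_def\<close>)
  then have "restriction (one_on \<Lambda>) \<in> H"
    by (rule restriction_in_H)
  also have "restriction (one_on \<Lambda>) = one_on X"
    by (auto simp: restriction_def one_on_def topspace_lambda beta_embed_in_lambda_set)
  finally show ?thesis .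
qed

end

theorem theorem2p3:
  fixes X :: "'a topology" and H :: "('a \<Rightarrow> 'k::real_or_complex) set"
  assumes "completely_regular_space X" and "Hausdorff_space X"
    and "banach_subalgebra X H"
    and "\<forall>x\<in>topspace X. \<exists>h\<in>H. h x \<noteq> 0"
    and "\<forall>f\<in>Cb X. (\<exists>h\<in>H. supp X f \<subseteq> supp X h) \<longrightarrow> f \<in> H"
  shows "(locally_compact_space (lambda_space X H) \<and> Hausdorff_space (lambda_space X H) \<and>
           isometrically_isomorphic H (C0 (lambda_space X H) :: ((('a \<Rightarrow> real) \<Rightarrow> real) \<Rightarrow> 'k) set)) \<and>
         (\<forall>Z :: 'c topology.
           locally_compact_space Z \<and> Hausdorff_space Z \<and>
           isometrically_isomorphic H (C0 Z :: ('c \<Rightarrow> 'k) set)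
           \<longrightarrow> Z homeomorphic_space lambda_space X H) \<and>
         (unital H \<longleftrightarrow> one_on X \<in> H) \<and>
         (one_on X \<in> H \<longleftrightarrow> compact_space (lambda_space X H)) \<and>
         (compact_space (lambda_space X H) \<longleftrightarrow> lambda_space X H = beta X)"
proof -
  interpret support_ideal X H
    using assms by unfold_locales
  have "Z homeomorphic_space lambda_space X H"
    if Z: "locally_compact_space Z" "Hausdorff_space Z" "isometrically_isomorphic H (C0 Z :: ('c \<Rightarrow> 'k) set)"
    for Z :: "'c topology"
  proof -
    obtain T :: "('a \<Rightarrow> 'k) \<Rightarrow> ('c \<Rightarrow> 'k)" where "isometric_isomorphism T H (C0 Z)"
      using Z(3) by (auto simp: isometrically_isomorphic_iff)
    \<comment> \<open>Passing through \<open>H\<close> gives an isomorphism between the two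
      \<open>C0\<close> algebras, to which the Banach-Stone theorem applies.\<close>
    from isometric_isomorphism_compose[OF isometric_isomorphism_restriction this]
    have "lambda_space X H homeomorphic_space Z"
      by (rule Banach_Stone_C0[OF locally_compact_lambda_space Hausdorff_lambda_space Z(1,2)])
    then show ?thesis
      by (subst homeomorphic_space_sym)
  qed
  moreover have "isometrically_isomorphic H (C0 (lambda_space X H) :: (_ \<Rightarrow> 'k) set)"
    unfolding isometrically_isomorphic_iff using isometric_isomorphism_H_C0 by blast
  \<comment> \<open>The equivalences close a cycle: the constant 1 in \<open>H\<close> gives
    equality with \<open>beta X\<close>, equality gives compactness, and compactness gives the
    constant 1.\<close>
  moreover have "one_on X \<in> H \<longleftrightarrow> compact_space (lambda_space X H)"
    "compact_space (lambda_space X H) \<longleftrightarrow> lambda_space X H = beta X"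
    using one_imp_lambda_space_eq_beta compact_lambda_space_imp_one compact_space_beta[of X] by auto
  ultimately show ?thesis
    using locally_compact_lambda_space Hausdorff_lambda_space unital_iff_one by blast
qed

end
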